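(* Let $R$ be a chain ring, $Z$ its set of zerodivisors and $N$ its nilradical. Then each ideal $I$ of $R$ is self-\underline{flat} if and only if $Z=N$.
   Context: All rings are commutative with unity. A chain ring (valuation ring) is a ring whose ideals are totally ordered by inclusion. The set $Z$ of zerodivisors includes $0$; it is a prime ideal. For $R$-modules $M$ and $V$, $V$ is $M$-\underline{flat} (the underlining distinguishes this notion from ordinary flatness) if for any $R$-module $M'$, any epimorphism $p:M\rightarrow M'$, any homomorphism $u:V\rightarrow M'$, any finitely presented $R$-module $G$ and any homomorphism $v:G\rightarrow V$, there exists a homomorphism $q:G\rightarrow M$ such that $pq=uv$. $V$ is self-\underline{flat} if $V$ is $V$-\underline{flat}. *)

theory Defs
  imports "HOL-Algebra.Algebra"
begin

section \<open>Chain rings\<close>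

locale chain_ring = cring +
  assumes ideals_chain: "\<lbrakk>ideal I R; ideal J R\<rbrakk> \<Longrightarrow> I \<subseteq> J \<or> J \<subseteq> I"

definition zerodivisors :: "('a, 'r) ring_scheme \<Rightarrow> 'a set" where
  \<comment> \<open>\<open>\<zero>\<close> is included by convention; the first disjunct matters only for the zero ring\<close>
  "zerodivisors R =
    {a \<in> carrier R. a = \<zero>\<^bsub>R\<^esub> \<or> (\<exists>b \<in> carrier R. b \<noteq> \<zero>\<^bsub>R\<^esub> \<and> a \<otimes>\<^bsub>R\<^esub> b = \<zero>\<^bsub>R\<^esub>)}"

definition nilradical :: "('a, 'r) ring_scheme \<Rightarrow> 'a set" where
  "nilradical R = {a \<in> carrier R. \<exists>n::nat. a [^]\<^bsub>R\<^esub> n = \<zero>\<^bsub>R\<^esub>}"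

section \<open>Module homomorphisms and finitely presented modules\<close>

definition mod_hom ::
    "('a, 'r) ring_scheme \<Rightarrow> ('a, 'b, 'm) module_scheme \<Rightarrow> ('a, 'c, 'n) module_scheme \<Rightarrow> ('b \<Rightarrow> 'c) set" where
  "mod_hom R M M' =
    {f \<in> carrier M \<rightarrow> carrier M'.
      (\<forall>x \<in> carrier M. \<forall>y \<in> carrier M. f (x \<oplus>\<^bsub>M\<^esub> y) = f x \<oplus>\<^bsub>M'\<^esub> f y) \<and>
      (\<forall>a \<in> carrier R. \<forall>x \<in> carrier M. f (a \<odot>\<^bsub>M\<^esub> x) = a \<odot>\<^bsub>M'\<^esub> f x)}"

definition mod_epi ::
    "('a, 'r) ring_scheme \<Rightarrow> ('a, 'b, 'm) module_scheme \<Rightarrow> ('a, 'c, 'n) module_scheme \<Rightarrow> ('b \<Rightarrow> 'c) set" where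
  "mod_epi R M M' = {f \<in> mod_hom R M M'. f ` carrier M = carrier M'}"

text \<open>The library's module record extends the ring record, so a value has to be given for the
  fields \<open>mult\<close> and \<open>one\<close> as well; they play no role in the module structure.\<close>

definition free_module :: "('a, 'r) ring_scheme \<Rightarrow> nat \<Rightarrow> ('a, nat \<Rightarrow> 'a) module" where
  "free_module R n =
    \<lparr>carrier = {..<n} \<rightarrow>\<^sub>E carrier R,
     monoid.mult = (\<lambda>x y. \<lambda>i\<in>{..<n}. x i \<otimes>\<^bsub>R\<^esub> y i),
     one = (\<lambda>i\<in>{..<n}. \<one>\<^bsub>R\<^esub>),
     ring.zero = (\<lambda>i\<in>{..<n}. \<zero>\<^bsub>R\<^esub>),
     ring.add = (\<lambda>x y. \<lambda>i\<in>{..<n}. x i \<oplus>\<^bsub>R\<^esub> y i),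
     module.smult = (\<lambda>a x. \<lambda>i\<in>{..<n}. a \<otimes>\<^bsub>R\<^esub> x i)\<rparr>"

definition ideal_module :: "('a, 'r) ring_scheme \<Rightarrow> 'a set \<Rightarrow> ('a, 'a) module" where
  "ideal_module R I =
    \<lparr>carrier = I, monoid.mult = monoid.mult R, one = \<one>\<^bsub>R\<^esub>, ring.zero = \<zero>\<^bsub>R\<^esub>,
     ring.add = ring.add R, module.smult = monoid.mult R\<rparr>"

definition fg_submodule :: "('a, 'r) ring_scheme \<Rightarrow> ('a, 'b, 'm) module_scheme \<Rightarrow> 'b set \<Rightarrow> bool" where
  "fg_submodule R M K \<longleftrightarrow>
    (\<exists>S. finite S \<and> S \<subseteq> carrier M \<and> K = (\<lambda>H. submodule H R M) hull S)"

definition finitely_presented :: "('a, 'r) ring_scheme \<Rightarrow> ('a, 'b, 'm) module_scheme \<Rightarrow> bool" where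
  "finitely_presented R G \<longleftrightarrow> module R G \<and>
    (\<exists>n. \<exists>f \<in> mod_epi R (free_module R n) G.
      fg_submodule R (free_module R n) {x \<in> carrier (free_module R n). f x = \<zero>\<^bsub>G\<^esub>})"

section \<open>Relative flatness\<close>

text \<open>\<open>rel_flat R M V\<close>: the module \<open>V\<close> is \<open>M\<close>-\<open>flat\<close> in the underlined sense. A definition
  cannot quantify over all types, so \<open>M'\<close> ranges over the modules whose elements are sets of elements
  of \<open>M\<close> (as for quotients of \<open>M\<close>), and \<open>G\<close> over the modules whose elements are sets of vectors over
  \<open>R\<close> (as for quotients of a finite free module). Every \<open>M'\<close> and \<open>G\<close> that can occur is isomorphic to
  one of these; the lemma \<open>rel_flatD\<close> below derives the property for \<open>M'\<close> and \<open>G\<close> over arbitrary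
  types.\<close>

definition rel_flat ::
    "('a, 'r) ring_scheme \<Rightarrow> ('a, 'b, 'm) module_scheme \<Rightarrow> ('a, 'c, 'n) module_scheme \<Rightarrow> bool" where
  "rel_flat R M V \<longleftrightarrow>
    (\<forall>(M' :: ('a, 'b set) module) p u (G :: ('a, (nat \<Rightarrow> 'a) set) module) v.
      module R M' \<and> p \<in> mod_epi R M M' \<and> u \<in> mod_hom R V M' \<and>
      finitely_presented R G \<and> v \<in> mod_hom R G V \<longrightarrow>
      (\<exists>q \<in> mod_hom R G M. \<forall>x \<in> carrier G. p (q x) = u (v x)))"

definition self_flat :: "('a, 'r) ring_scheme \<Rightarrow> ('a, 'b, 'm) module_scheme \<Rightarrow> bool" where
  "self_flat R V \<longleftrightarrow> rel_flat R V V"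

subsection \<open>Independence of the types of the test modules\<close>

definition transport_module ::
    "('b \<Rightarrow> 'e) \<Rightarrow> ('a, 'b, 'm) module_scheme \<Rightarrow> ('a, 'e) module" where
  "transport_module g M = (let h = inv_into (carrier M) g in
    \<lparr>carrier = g ` carrier M,
     monoid.mult = (\<lambda>x y. g (h x \<otimes>\<^bsub>M\<^esub> h y)),
     one = g \<one>\<^bsub>M\<^esub>,
     ring.zero = g \<zero>\<^bsub>M\<^esub>,
     ring.add = (\<lambda>x y. g (h x \<oplus>\<^bsub>M\<^esub> h y)),
     module.smult = (\<lambda>a x. g (a \<odot>\<^bsub>M\<^esub> h x))\<rparr>)"

lemma transport_module_simps:
  assumes "inj_on g (carrier M)"
  shows "carrier (transport_module g M) = g ` carrier M"
    and "\<zero>\<^bsub>transport_module g M\<^esub> = g \<zero>\<^bsub>M\<^esub>"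
    and "\<lbrakk>x \<in> carrier M; y \<in> carrier M\<rbrakk> \<Longrightarrow> g x \<oplus>\<^bsub>transport_module g M\<^esub> g y = g (x \<oplus>\<^bsub>M\<^esub> y)"
    and "x \<in> carrier M \<Longrightarrow> a \<odot>\<^bsub>transport_module g M\<^esub> g x = g (a \<odot>\<^bsub>M\<^esub> x)"
  using assms by (simp_all add: transport_module_def Let_def inv_into_f_f)

lemma transport_module:
  assumes M: "module R M" and g: "inj_on g (carrier M)"
  shows "module R (transport_module g M)"
proof -
  interpret module R M by (rule M)
  note s = transport_module_simps[OF g]
  show ?thesis
  proof (rule moduleI)
    show "abelian_group (transport_module g M)"
    proof (rule abelian_groupI)
      fix x assume "x \<in> carrier (transport_module g M)"
      then obtain x' where x: "x' \<in> carrier M" "x = g x'" by (auto simp: s)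
      have "g (\<ominus>\<^bsub>M\<^esub> x') \<oplus>\<^bsub>transport_module g M\<^esub> g x' = \<zero>\<^bsub>transport_module g M\<^esub>"
        using x by (simp add: s M.l_neg)
      then show "\<exists>y\<in>carrier (transport_module g M). y \<oplus>\<^bsub>transport_module g M\<^esub> x = \<zero>\<^bsub>transport_module g M\<^esub>"
        using x by (auto simp: s(1))
    qed (auto simp: s M.a_ac)
  qed (auto simp: s R.is_cring smult_l_distr smult_r_distr smult_assoc1)
qed

lemma transport_module_hom:
  assumes "module R M" and "inj_on g (carrier M)"
  shows "g \<in> mod_epi R M (transport_module g M)"
    and "inv_into (carrier M) g \<in> mod_hom R (transport_module g M) M"
proof -
  interpret module R M by (rule assms)
  note s = transport_module_simps[OF assms(2)]
  show "g \<in> mod_epi R M (transport_module g M)"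
    by (auto simp: mod_epi_def mod_hom_def s)
  show "inv_into (carrier M) g \<in> mod_hom R (transport_module g M) M"
    using assms(2) by (auto simp: mod_hom_def s inv_into_f_f)
qed

lemma mod_hom_comp:
  "\<lbrakk>f \<in> mod_hom R M M'; g \<in> mod_hom R M' M''\<rbrakk> \<Longrightarrow> g \<circ> f \<in> mod_hom R M M''"
  by (simp add: mod_hom_def Pi_iff)

lemma mod_epi_comp:
  "\<lbrakk>f \<in> mod_epi R M M'; g \<in> mod_epi R M' M''\<rbrakk> \<Longrightarrow> g \<circ> f \<in> mod_epi R M M''"
  unfolding mod_epi_def using mod_hom_comp [of f R M M' g M'']
  by (simp del: o_apply flip: image_comp)

lemma finitely_presented_transport:
  assumes G: "finitely_presented R G" and g: "inj_on g (carrier G)"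
  shows "finitely_presented R (transport_module g G)"
proof -
  from G obtain n f where M: "module R G" and f: "f \<in> mod_epi R (free_module R n) G"
    and K: "fg_submodule R (free_module R n) {x \<in> carrier (free_module R n). f x = \<zero>\<^bsub>G\<^esub>}"
    by (auto simp: finitely_presented_def)
  interpret module R G by (rule M)
  have c: "f x \<in> carrier G" if "x \<in> carrier (free_module R n)" for x
    using f that by (auto simp: mod_epi_def)
  have *: "{x \<in> carrier (free_module R n). (g \<circ> f) x = \<zero>\<^bsub>transport_module g G\<^esub>}
      = {x \<in> carrier (free_module R n). f x = \<zero>\<^bsub>G\<^esub>}"
    using c g by (auto simp: transport_module_simps[OF g] inj_on_eq_iff)
  show ?thesis
    unfolding finitely_presented_def
  proof (intro conjI exI bexI)
    show "module R (transport_module g G)"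
      by (rule transport_module[OF M g])
    show "g \<circ> f \<in> mod_epi R (free_module R n) (transport_module g G)"
      by (rule mod_epi_comp[OF f transport_module_hom(1)[OF M g]])
    show "fg_submodule R (free_module R n)
        {x \<in> carrier (free_module R n). (g \<circ> f) x = \<zero>\<^bsub>transport_module g G\<^esub>}"
      unfolding * by (rule K)
  qed
qed

lemma inj_on_fibres: "inj_on (\<lambda>y. {x \<in> A. f x = y}) (f ` A)"
  by (rule inj_onI) blast

lemma rel_flatD:
  assumes "rel_flat R M V"
    and "module R M'" and p: "p \<in> mod_epi R M M'" and u: "u \<in> mod_hom R V M'"
    and G: "finitely_presented R G" and v: "v \<in> mod_hom R G V"
  shows "\<exists>q \<in> mod_hom R G M. \<forall>x \<in> carrier G. p (q x) = u (v x)"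
proof -
  from G have mG: "module R G" by (simp add: finitely_presented_def)
  from G obtain n f where f: "f \<in> mod_epi R (free_module R n) G"
    by (auto simp: finitely_presented_def)
  define g where "g = (\<lambda>y. {x \<in> carrier M. p x = y})"
  define h where "h = (\<lambda>y. {x \<in> carrier (free_module R n). f x = y})"
  have g: "inj_on g (carrier M')"
    using p inj_on_fibres[where f = p and A = "carrier M"] by (simp add: g_def mod_epi_def)
  have h: "inj_on h (carrier G)"
    using f inj_on_fibres[where f = f and A = "carrier (free_module R n)"]
    by (simp add: h_def mod_epi_def)
  let ?k = "inv_into (carrier G) h"
  note hg = transport_module_hom[OF assms(2) g] and hh = transport_module_hom[OF mG h]
  have "g \<circ> u \<in> mod_hom R V (transport_module g M')"
    using u hg(1) by (auto simp: mod_epi_def intro: mod_hom_comp)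
  moreover have "g \<circ> p \<in> mod_epi R M (transport_module g M')"
    using p hg(1) by (rule mod_epi_comp)
  moreover have "v \<circ> ?k \<in> mod_hom R (transport_module h G) V"
    using hh(2) v by (rule mod_hom_comp)
  ultimately obtain q where q: "q \<in> mod_hom R (transport_module h G) M"
    and eq: "\<forall>x \<in> carrier (transport_module h G). (g \<circ> p) (q x) = (g \<circ> u) ((v \<circ> ?k) x)"
    using assms(1) transport_module[OF assms(2) g] finitely_presented_transport[OF G h]
    unfolding rel_flat_def by blast
  have "q \<circ> h \<in> mod_hom R G M"
    using hh(1) q by (auto simp: mod_epi_def intro: mod_hom_comp)
  moreover have "p ((q \<circ> h) x) = u (v x)" if x: "x \<in> carrier G" for x
  proof -
    have hx: "h x \<in> carrier (transport_module h G)"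
      using x by (simp add: transport_module_simps(1)[OF h])
    then have "g (p (q (h x))) = g (u (v x))"
      using eq x h by (auto simp: inv_into_f_f)
    moreover have "p (q (h x)) \<in> carrier M'" "u (v x) \<in> carrier M'"
      using p q u v x hx by (auto simp: mod_epi_def mod_hom_def)
    ultimately show ?thesis using g by (auto dest: inj_onD)
  qed
  ultimately show ?thesis by blast
qed

end

theory Submission
  imports Defs
begin

text \<open>
  In a chain ring the test for flatness collapses to one about single elements. Let \<open>f\<close> map a free
  module of finite rank onto \<open>G\<close>, and let \<open>v\<close> map \<open>G\<close> to an ideal \<open>I\<close>. Among finitely many elements
  of \<open>R\<close> one divides all others (\<open>finite_common_divisor\<close>), so the image of \<open>v\<close> is generated by one
  \<open>b \<in> I\<close> and \<open>v (f x) = \<phi> x \<otimes> b\<close> for a linear form \<open>\<phi>\<close>. For the same reason \<open>\<phi>\<close> maps the finitely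
  generated kernel of \<open>f\<close> into the multiples of a single \<open>a\<close> with \<open>a \<otimes> b = \<zero>\<close>. Thus \<open>v\<close> factors through
  \<open>R/aR\<close>, and a lift \<open>q\<close> of \<open>u \<circ> v\<close> along \<open>p\<close> exists as soon as some \<open>y \<in> I\<close> has \<open>a \<otimes> y = \<zero>\<close> and
  \<open>p y = u b\<close>: take \<open>q (f x) = \<phi> x \<otimes> y\<close>.

  Suppose that every zerodivisor is nilpotent, and choose \<open>c \<in> I\<close> with \<open>p c = u b\<close>. Either \<open>\<zero>\<close> or \<open>c\<close>
  serves as \<open>y\<close> unless \<open>p c \<noteq> 0\<close> and \<open>a \<otimes> c \<noteq> \<zero>\<close>. In that last case \<open>c\<close> is no multiple of \<open>b\<close>, so
  \<open>b = r \<otimes> c\<close>, and \<open>r\<close> is a zerodivisor because \<open>r \<otimes> (a \<otimes> c) = a \<otimes> b = \<zero>\<close>. Now \<open>p c = r \<odot> u c\<close>. Choosing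
  \<open>d \<in> I\<close> with \<open>p d = u c\<close>, the elements \<open>c\<close> and \<open>r \<otimes> d\<close> agree modulo the kernel of \<open>p\<close>, which consists
  of proper multiples of \<open>c\<close>; as \<open>R\<close> is local, \<open>c\<close> is then a multiple of \<open>r \<otimes> d\<close>, and \<open>d\<close> inherits the
  situation of \<open>c\<close>. Iterating, \<open>c\<close> is divisible by all powers of \<open>r\<close> (\<open>divisible_by_powers\<close>), hence
  \<open>c = \<zero>\<close>, a contradiction (\<open>annihilated_lift\<close>).

  Conversely let \<open>s\<close> be a zerodivisor that is not nilpotent, \<open>s \<otimes> t = \<zero>\<close> with \<open>t \<noteq> \<zero>\<close>. The intersection
  \<open>I\<close> of the ideals \<open>s\<^sup>nR\<close> satisfies \<open>sI = I\<close> and contains \<open>t\<close> (\<open>Inter_powers\<close>). Multiplication by \<open>s\<close>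
  is therefore an epimorphism \<open>I \<rightarrow> I\<close>. The homomorphism \<open>R/sR \<rightarrow> I\<close> with \<open>1 \<mapsto> t\<close> does not lift along it:
  every homomorphism \<open>q\<close> from \<open>R/sR\<close> satisfies \<open>s \<otimes> q 1 = \<zero>\<close>, whereas a lift needs \<open>s \<otimes> q 1 = t\<close>.
\<close>

section \<open>Module homomorphisms\<close>

lemma mod_homD:
  assumes "f \<in> mod_hom R M M'"
  shows "x \<in> carrier M \<Longrightarrow> f x \<in> carrier M'"
    and "\<lbrakk>x \<in> carrier M; y \<in> carrier M\<rbrakk> \<Longrightarrow> f (x \<oplus>\<^bsub>M\<^esub> y) = f x \<oplus>\<^bsub>M'\<^esub> f y"
    and "\<lbrakk>a \<in> carrier R; x \<in> carrier M\<rbrakk> \<Longrightarrow> f (a \<odot>\<^bsub>M\<^esub> x) = a \<odot>\<^bsub>M'\<^esub> f x"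
  using assms by (auto simp: mod_hom_def)

lemma mod_hom_zero:
  assumes "module R M" "module R M'" "f \<in> mod_hom R M M'"
  shows "f \<zero>\<^bsub>M\<^esub> = \<zero>\<^bsub>M'\<^esub>"
proof -
  interpret M: module R M by (rule assms)
  interpret M': module R M' by (rule assms)
  have "f (\<zero>\<^bsub>R\<^esub> \<odot>\<^bsub>M\<^esub> \<zero>\<^bsub>M\<^esub>) = \<zero>\<^bsub>R\<^esub> \<odot>\<^bsub>M'\<^esub> f \<zero>\<^bsub>M\<^esub>"
    by (rule mod_homD(3)[OF assms(3)]) auto
  then show ?thesis using mod_homD(1)[OF assms(3)] by simp
qed

lemma mod_hom_a_inv:
  assumes "module R M" "module R M'" "f \<in> mod_hom R M M'" and x: "x \<in> carrier M"
  shows "f (\<ominus>\<^bsub>M\<^esub> x) = \<ominus>\<^bsub>M'\<^esub> f x"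
proof -
  interpret M: module R M by (rule assms)
  interpret M': module R M' by (rule assms)
  have "f ((\<ominus>\<^bsub>R\<^esub> \<one>\<^bsub>R\<^esub>) \<odot>\<^bsub>M\<^esub> x) = (\<ominus>\<^bsub>R\<^esub> \<one>\<^bsub>R\<^esub>) \<odot>\<^bsub>M'\<^esub> f x"
    by (rule mod_homD(3)[OF assms(3)]) (auto simp: x)
  then show ?thesis
    using x mod_homD(1)[OF assms(3)] by (simp add: M.smult_l_minus M'.smult_l_minus)
qed

lemma submodule_kernel:
  assumes M: "module R M" and M': "module R M'" and f: "f \<in> mod_hom R M M'"
  shows "submodule {x \<in> carrier M. f x = \<zero>\<^bsub>M'\<^esub>} R M"
proof -
  interpret M: module R M by (rule M)
  interpret M': module R M' by (rule M')
  show ?thesis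
    by (rule M.submoduleI)
      (auto simp: mod_homD[OF f] mod_hom_zero[OF M M' f] mod_hom_a_inv[OF M M' f])
qed

text \<open>The homomorphism theorem. Homomorphisms out of a finitely presented module are obtained with it from
  homomorphisms out of a free module.\<close>

lemma mod_epi_factor:
  assumes F: "module R F" and G: "module R G" and V: "module R V"
    and f: "f \<in> mod_epi R F G" and h: "h \<in> mod_hom R F V"
    and ker: "\<And>x. \<lbrakk>x \<in> carrier F; f x = \<zero>\<^bsub>G\<^esub>\<rbrakk> \<Longrightarrow> h x = \<zero>\<^bsub>V\<^esub>"
  obtains q where "q \<in> mod_hom R G V" "\<And>x. x \<in> carrier F \<Longrightarrow> q (f x) = h x"
proof -
  interpret F: module R F by (rule F)
  interpret G: module R G by (rule G)
  interpret V: module R V by (rule V)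
  have fh: "f \<in> mod_hom R F G" and im: "f ` carrier F = carrier G"
    using f by (auto simp: mod_epi_def)
  have eq: "h x = h y" if x: "x \<in> carrier F" and y: "y \<in> carrier F" and xy: "f x = f y" for x y
  proof -
    have "f (x \<oplus>\<^bsub>F\<^esub> \<ominus>\<^bsub>F\<^esub> y) = \<zero>\<^bsub>G\<^esub>"
      using x y xy mod_homD[OF fh] by (simp add: mod_hom_a_inv[OF F G fh] G.r_neg)
    then have "h (x \<oplus>\<^bsub>F\<^esub> \<ominus>\<^bsub>F\<^esub> y) = \<zero>\<^bsub>V\<^esub>" using x y by (intro ker) auto
    then have "h x \<oplus>\<^bsub>V\<^esub> \<ominus>\<^bsub>V\<^esub> h y = \<zero>\<^bsub>V\<^esub>"
      using x y mod_homD[OF h] by (simp add: mod_hom_a_inv[OF F V h])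
    then show ?thesis
      using x y mod_homD(1)[OF h] by (metis V.minus_equality V.minus_minus V.a_inv_closed)
  qed
  define q where "q = (\<lambda>g. h (inv_into (carrier F) f g))"
  have qf: "q (f x) = h x" if "x \<in> carrier F" for x
    unfolding q_def using that by (intro eq) (auto intro: inv_into_into f_inv_into_f)
  have "q \<in> mod_hom R G V"
    unfolding mod_hom_def
  proof (intro CollectI conjI ballI Pi_I)
    fix g assume "g \<in> carrier G"
    then obtain x where "x \<in> carrier F" "g = f x" using im by auto
    then show "q g \<in> carrier V" using qf mod_homD(1)[OF h] by simp
  next
    fix g g' assume "g \<in> carrier G" "g' \<in> carrier G"
    then obtain x x' where x: "x \<in> carrier F" "g = f x" "x' \<in> carrier F" "g' = f x'"
      using im by (metis imageE)
    then have "q (g \<oplus>\<^bsub>G\<^esub> g') = q (f (x \<oplus>\<^bsub>F\<^esub> x'))" by (simp add: mod_homD[OF fh])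
    also have "\<dots> = q g \<oplus>\<^bsub>V\<^esub> q g'" using x by (simp add: qf mod_homD[OF h])
    finally show "q (g \<oplus>\<^bsub>G\<^esub> g') = q g \<oplus>\<^bsub>V\<^esub> q g'" .
  next
    fix a g assume a: "a \<in> carrier R" and "g \<in> carrier G"
    then obtain x where x: "x \<in> carrier F" "g = f x" using im by auto
    then have "q (a \<odot>\<^bsub>G\<^esub> g) = q (f (a \<odot>\<^bsub>F\<^esub> x))" using a by (simp add: mod_homD[OF fh])
    also have "\<dots> = a \<odot>\<^bsub>V\<^esub> q g" using x a by (simp add: qf mod_homD[OF h])
    finally show "q (a \<odot>\<^bsub>G\<^esub> g) = a \<odot>\<^bsub>V\<^esub> q g" .
  qed
  then show ?thesis using qf that by blast
qed

section \<open>Ideals, cyclic modules and free modules as modules\<close>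

lemma ideal_module_simps [simp]:
  "carrier (ideal_module R I) = I" "\<zero>\<^bsub>ideal_module R I\<^esub> = \<zero>\<^bsub>R\<^esub>"
  "x \<oplus>\<^bsub>ideal_module R I\<^esub> y = x \<oplus>\<^bsub>R\<^esub> y" "x \<odot>\<^bsub>ideal_module R I\<^esub> y = x \<otimes>\<^bsub>R\<^esub> y"
  by (simp_all add: ideal_module_def)

lemma (in cring) module_ideal_module:
  assumes "ideal I R"
  shows "module R (ideal_module R I)"
proof -
  interpret I: ideal I R by (rule assms)
  show ?thesis
  proof (rule moduleI[OF is_cring])
    show "abelian_group (ideal_module R I)"
    proof (rule abelian_groupI)
      fix x assume "x \<in> carrier (ideal_module R I)"
      then show "\<exists>y\<in>carrier (ideal_module R I). y \<oplus>\<^bsub>ideal_module R I\<^esub> x = \<zero>\<^bsub>ideal_module R I\<^esub>"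
        by (intro bexI[of _ "\<ominus> x"]) (simp_all add: l_neg)
    qed (auto simp: a_ac)
  qed (auto simp: l_distr r_distr m_assoc I.I_l_closed)
qed

definition quotient_module :: "('a, 'r) ring_scheme \<Rightarrow> 'a set \<Rightarrow> ('a, 'a set) module" where
  "quotient_module R I =
    \<lparr>carrier = carrier (R Quot I), monoid.mult = monoid.mult (R Quot I), one = one (R Quot I),
     ring.zero = ring.zero (R Quot I), ring.add = ring.add (R Quot I),
     module.smult = (\<lambda>a A. (I +>\<^bsub>R\<^esub> a) \<otimes>\<^bsub>R Quot I\<^esub> A)\<rparr>"

lemma quotient_module_simps [simp]:
  "carrier (quotient_module R I) = carrier (R Quot I)"
  "\<zero>\<^bsub>quotient_module R I\<^esub> = \<zero>\<^bsub>R Quot I\<^esub>"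
  "A \<oplus>\<^bsub>quotient_module R I\<^esub> B = A \<oplus>\<^bsub>R Quot I\<^esub> B"
  "a \<odot>\<^bsub>quotient_module R I\<^esub> A = (I +>\<^bsub>R\<^esub> a) \<otimes>\<^bsub>R Quot I\<^esub> A"
  by (simp_all add: quotient_module_def)

lemma (in cring) module_quotient_module:
  assumes "ideal I R"
  shows "module R (quotient_module R I)"
proof -
  interpret I: ideal I R by (rule assms)
  interpret Q: cring "R Quot I" by (rule I.quotient_is_cring[OF is_cring])
  interpret h: ring_hom_ring R "R Quot I" "(+>) I" by (rule I.rcos_ring_hom_ring)
  show ?thesis
  proof (rule moduleI[OF is_cring])
    show "abelian_group (quotient_module R I)"
    proof (rule abelian_groupI)
      fix x assume "x \<in> carrier (quotient_module R I)"
      then show "\<exists>y\<in>carrier (quotient_module R I).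
          y \<oplus>\<^bsub>quotient_module R I\<^esub> x = \<zero>\<^bsub>quotient_module R I\<^esub>"
        by (intro bexI[of _ "\<ominus>\<^bsub>R Quot I\<^esub> x"]) (simp_all add: Q.l_neg)
    qed (auto simp: Q.a_ac)
  qed (auto simp: Q.l_distr Q.r_distr Q.m_assoc)
qed

lemma free_module_simps [simp]:
  "carrier (free_module R n) = {..<n} \<rightarrow>\<^sub>E carrier R"
  "\<zero>\<^bsub>free_module R n\<^esub> = (\<lambda>i\<in>{..<n}. \<zero>\<^bsub>R\<^esub>)"
  "x \<oplus>\<^bsub>free_module R n\<^esub> y = (\<lambda>i\<in>{..<n}. x i \<oplus>\<^bsub>R\<^esub> y i)"
  "a \<odot>\<^bsub>free_module R n\<^esub> x = (\<lambda>i\<in>{..<n}. a \<otimes>\<^bsub>R\<^esub> x i)"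
  by (simp_all add: free_module_def)

lemma (in cring) module_free_module: "module R (free_module R n)"
proof (rule moduleI[OF is_cring])
  show "abelian_group (free_module R n)"
  proof (rule abelian_groupI)
    fix x assume x: "x \<in> carrier (free_module R n)"
    then show "\<exists>y\<in>carrier (free_module R n). y \<oplus>\<^bsub>free_module R n\<^esub> x = \<zero>\<^bsub>free_module R n\<^esub>"
      by (intro bexI[of _ "\<lambda>i\<in>{..<n}. \<ominus> x i"]) (auto simp: l_neg PiE_iff fun_eq_iff restrict_def extensional_def)
  qed (auto simp: PiE_iff fun_eq_iff restrict_def extensional_def a_ac)
qed (auto simp: PiE_iff fun_eq_iff restrict_def extensional_def l_distr r_distr m_assoc)

text \<open>Induction on the number of leading coordinates of \<open>x\<close> that are kept, the others being replaced by
  \<open>\<zero>\<close>. The sum is taken in \<open>R\<close> rather than in \<open>ideal_module R I\<close>, so that the ring laws for finite sums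
  apply to it.\<close>

lemma (in cring) mod_hom_free_module_expand:
  assumes I: "ideal I R" and h: "h \<in> mod_hom R (free_module R n) (ideal_module R I)"
    and x: "x \<in> {..<n} \<rightarrow>\<^sub>E carrier R"
  shows "h x = (\<Oplus>i\<in>{..<n}. x i \<otimes> h (\<lambda>j\<in>{..<n}. if j = i then \<one> else \<zero>))"
proof -
  interpret I: ideal I R by (rule I)
  let ?F = "free_module R n"
  define e where "e = (\<lambda>i. \<lambda>j\<in>{..<n}. if j = i then \<one> else \<zero>)"
  define t where "t = (\<lambda>m. \<lambda>j\<in>{..<n}. if j < m then x j else \<zero>)"
  have xc: "x i \<in> carrier R" if "i < n" for i using x that by auto
  have ec: "e i \<in> carrier ?F" for i by (auto simp: e_def)
  have he: "h (e i) \<in> carrier R" for i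
    using mod_homD(1)[OF h ec] by (auto intro: I.Icarr)
  have "h (t m) = (\<Oplus>i\<in>{..<m}. x i \<otimes> h (e i))" if "m \<le> n" for m
    using that
  proof (induction m)
    case 0
    have "t 0 = \<zero>\<^bsub>?F\<^esub>" by (simp add: t_def)
    then have "h (t 0) = h \<zero>\<^bsub>?F\<^esub>" by (rule arg_cong)
    also have "\<dots> = \<zero>"
      using mod_hom_zero[OF module_free_module module_ideal_module[OF I] h] by simp
    finally show ?case by simp
  next
    case (Suc m)
    have tc: "t m \<in> carrier ?F" using xc by (auto simp: t_def)
    have "t (Suc m) = t m \<oplus>\<^bsub>?F\<^esub> x m \<odot>\<^bsub>?F\<^esub> e m"
      using Suc.prems xc by (auto simp: restrict_def t_def e_def fun_eq_iff less_Suc_eq)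
    then have "h (t (Suc m)) = h (t m \<oplus>\<^bsub>?F\<^esub> x m \<odot>\<^bsub>?F\<^esub> e m)" by (rule arg_cong)
    also have "\<dots> = h (t m) \<oplus> h (x m \<odot>\<^bsub>?F\<^esub> e m)"
      using mod_homD(2)[OF h tc, of "x m \<odot>\<^bsub>?F\<^esub> e m"] Suc.prems xc ec[of m] by (simp add: PiE_iff)
    also have "h (x m \<odot>\<^bsub>?F\<^esub> e m) = x m \<otimes> h (e m)"
      using mod_homD(3)[OF h _ ec, of "x m"] Suc.prems xc by simp
    also have "h (t m) = (\<Oplus>i\<in>{..<m}. x i \<otimes> h (e i))"
      by (rule Suc.IH) (use Suc.prems in simp)
    finally show ?case
      using Suc.prems xc he by (simp add: lessThan_Suc a_comm)
  qed
  from this[of n] have "h (t n) = (\<Oplus>i\<in>{..<n}. x i \<otimes> h (e i))" by simp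
  moreover have "t n = x" using x by (auto simp: t_def fun_eq_iff restrict_def PiE_def extensional_def)
  ultimately show ?thesis by (simp add: e_def)
qed

text \<open>The linear form with coefficients \<open>r\<close>, followed by \<open>a \<mapsto> a \<otimes> y\<close>. The maps into \<open>I\<close> that occur in
  the lifting problem are all of this shape.\<close>

lemma (in cring) linear_form_mod_hom:
  assumes I: "ideal I R" and r: "r \<in> {..<n} \<rightarrow> carrier R" and y: "y \<in> I"
  shows "(\<lambda>x. (\<Oplus>i\<in>{..<n}. x i \<otimes> r i) \<otimes> y) \<in> mod_hom R (free_module R n) (ideal_module R I)"
proof -
  interpret I: ideal I R by (rule I)
  have rc: "\<And>i. i < n \<Longrightarrow> r i \<in> carrier R" using r by auto
  have yc: "y \<in> carrier R" using y by (rule I.Icarr)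
  have sc: "(\<Oplus>i\<in>{..<n}. x i \<otimes> r i) \<in> carrier R" if "x \<in> {..<n} \<rightarrow>\<^sub>E carrier R" for x
    using that rc by (intro finsum_closed) auto
  show ?thesis
    unfolding mod_hom_def
  proof (intro CollectI conjI ballI Pi_I)
    fix x assume "x \<in> carrier (free_module R n)"
    then show "(\<Oplus>i\<in>{..<n}. x i \<otimes> r i) \<otimes> y \<in> carrier (ideal_module R I)"
      using sc y by (simp add: I.I_l_closed)
  next
    fix x x' assume "x \<in> carrier (free_module R n)" "x' \<in> carrier (free_module R n)"
    then have x: "x \<in> {..<n} \<rightarrow>\<^sub>E carrier R" "x' \<in> {..<n} \<rightarrow>\<^sub>E carrier R" by auto
    then have xc: "\<And>i. i < n \<Longrightarrow> x i \<in> carrier R" "\<And>i. i < n \<Longrightarrow> x' i \<in> carrier R" by auto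
    have "(\<Oplus>i\<in>{..<n}. (x \<oplus>\<^bsub>free_module R n\<^esub> x') i \<otimes> r i)
        = (\<Oplus>i\<in>{..<n}. x i \<otimes> r i \<oplus> x' i \<otimes> r i)"
      by (rule finsum_cong') (auto simp: l_distr xc rc)
    also have "\<dots> = (\<Oplus>i\<in>{..<n}. x i \<otimes> r i) \<oplus> (\<Oplus>i\<in>{..<n}. x' i \<otimes> r i)"
      by (rule finsum_addf) (auto simp: xc rc)
    finally show "(\<Oplus>i\<in>{..<n}. (x \<oplus>\<^bsub>free_module R n\<^esub> x') i \<otimes> r i) \<otimes> y
        = (\<Oplus>i\<in>{..<n}. x i \<otimes> r i) \<otimes> y \<oplus>\<^bsub>ideal_module R I\<^esub> (\<Oplus>i\<in>{..<n}. x' i \<otimes> r i) \<otimes> y"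
      using sc[OF x(1)] sc[OF x(2)] yc by (simp add: l_distr)
  next
    fix a x assume a: "a \<in> carrier R" and "x \<in> carrier (free_module R n)"
    then have x: "x \<in> {..<n} \<rightarrow>\<^sub>E carrier R" by auto
    then have xc: "\<And>i. i < n \<Longrightarrow> x i \<in> carrier R" by auto
    have "(\<Oplus>i\<in>{..<n}. (a \<odot>\<^bsub>free_module R n\<^esub> x) i \<otimes> r i) = (\<Oplus>i\<in>{..<n}. a \<otimes> (x i \<otimes> r i))"
      by (rule finsum_cong') (auto simp: m_assoc xc rc a)
    also have "\<dots> = a \<otimes> (\<Oplus>i\<in>{..<n}. x i \<otimes> r i)"
      using a xc rc by (intro finsum_rdistr[symmetric]) auto
    finally show "(\<Oplus>i\<in>{..<n}. (a \<odot>\<^bsub>free_module R n\<^esub> x) i \<otimes> r i) \<otimes> y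
        = a \<odot>\<^bsub>ideal_module R I\<^esub> ((\<Oplus>i\<in>{..<n}. x i \<otimes> r i) \<otimes> y)"
      using sc[OF x] yc a by (simp add: m_assoc)
  qed
qed

lemma carrier_FactRing: "carrier (R Quot I) = (\<lambda>a. I +>\<^bsub>R\<^esub> a) ` carrier R"
  unfolding FactRing_def A_RCOSETS_def' by auto

lemma (in ideal) rcos_eq_zero_iff:
  assumes "a \<in> carrier R"
  shows "I +> a = \<zero>\<^bsub>R Quot I\<^esub> \<longleftrightarrow> a \<in> I"
proof -
  have "\<zero>\<^bsub>R Quot I\<^esub> = I" by (simp add: FactRing_def)
  then show ?thesis using a_rcos_const a_rcos_self[OF assms] by metis
qed

text \<open>One generator and one relation; the kernel of \<open>R \<rightarrow> R/sR\<close> is spanned by \<open>s\<close> because a vector of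
  length 1 is determined by its only entry.\<close>

lemma (in cring) quotient_module_presentation:
  assumes s: "s \<in> carrier R"
  shows "(\<lambda>x. (PIdl s) +> x 0) \<in> mod_epi R (free_module R 1) (quotient_module R (PIdl s))"
    and "finitely_presented R (quotient_module R (PIdl s))"
proof -
  let ?I = "PIdl s" and ?F = "free_module R 1" and ?f = "\<lambda>x. (PIdl s) +> x 0"
  interpret I: ideal ?I R by (rule cgenideal_ideal[OF s])
  interpret Q: cring "R Quot ?I" by (rule I.quotient_is_cring[OF is_cring])
  interpret h: ring_hom_ring R "R Quot ?I" "(+>) ?I" by (rule I.rcos_ring_hom_ring)
  interpret F: module R ?F by (rule module_free_module)
  note Q = module_quotient_module[OF I.ideal_axioms]
  have x0: "x 0 \<in> carrier R" if "x \<in> carrier ?F" for x using that by auto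
  have fh: "?f \<in> mod_hom R ?F (quotient_module R ?I)"
    unfolding mod_hom_def
  proof (intro CollectI conjI ballI Pi_I)
    fix x assume "x \<in> carrier ?F"
    then show "?f x \<in> carrier (quotient_module R ?I)" using h.hom_closed[OF x0] by simp
  next
    fix x y assume "x \<in> carrier ?F" "y \<in> carrier ?F"
    then show "?f (x \<oplus>\<^bsub>?F\<^esub> y) = ?f x \<oplus>\<^bsub>quotient_module R ?I\<^esub> ?f y"
      using h.hom_add[OF x0 x0] by simp
  next
    fix a x assume "a \<in> carrier R" "x \<in> carrier ?F"
    then show "?f (a \<odot>\<^bsub>?F\<^esub> x) = a \<odot>\<^bsub>quotient_module R ?I\<^esub> ?f x"
      using h.hom_mult[OF _ x0] by simp
  qed
  have "carrier (R Quot ?I) \<subseteq> ?f ` carrier ?F"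
  proof
    fix A assume "A \<in> carrier (R Quot ?I)"
    then obtain a where a: "a \<in> carrier R" "A = ?I +> a" unfolding carrier_FactRing by blast
    then show "A \<in> ?f ` carrier ?F"
      by (intro image_eqI[of _ _ "\<lambda>i\<in>{..<1}. a"]) auto
  qed
  then show f: "?f \<in> mod_epi R ?F (quotient_module R ?I)"
    using fh mod_homD(1)[OF fh] by (auto simp: mod_epi_def)
  let ?K = "{x \<in> carrier ?F. ?f x = \<zero>\<^bsub>quotient_module R ?I\<^esub>}"
  let ?s = "\<lambda>i\<in>{..<1::nat}. s"
  have "?K = (\<lambda>H. submodule H R ?F) hull {?s}"
  proof (rule hull_unique[symmetric])
    have "?s \<in> carrier ?F" using s by auto
    moreover have "?f ?s = \<zero>\<^bsub>quotient_module R ?I\<^esub>"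
      using I.rcos_eq_zero_iff[OF s] cgenideal_self[OF s] by simp
    ultimately show "{?s} \<subseteq> ?K" by simp
    show "submodule ?K R ?F"
      by (rule submodule_kernel[OF F.module_axioms Q fh])
  next
    fix H assume H: "{?s} \<subseteq> H" "submodule H R ?F"
    show "?K \<subseteq> H"
    proof
      fix x assume "x \<in> ?K"
      then have x: "x \<in> {..<1} \<rightarrow>\<^sub>E carrier R" "x 0 \<in> ?I" using I.rcos_eq_zero_iff[of "x 0"] by auto
      then obtain a where a: "a \<in> carrier R" "x 0 = a \<otimes> s" unfolding cgenideal_def by blast
      have "a \<odot>\<^bsub>?F\<^esub> ?s \<in> H" by (rule submodule.smult_closed[OF H(2) a(1)]) (use H(1) in blast)
      moreover have "a \<odot>\<^bsub>?F\<^esub> ?s = x"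
        using x a by (auto simp: fun_eq_iff restrict_def PiE_def extensional_def)
      ultimately show "x \<in> H" by simp
    qed
  qed
  moreover have "{?s} \<subseteq> carrier ?F" using s by auto
  ultimately have "fg_submodule R ?F ?K"
    unfolding fg_submodule_def by (intro exI[of _ "{?s}"]) simp
  with f Q show "finitely_presented R (quotient_module R ?I)"
    unfolding finitely_presented_def by (intro conjI exI[of _ 1] bexI[of _ ?f])
qed

section \<open>Divisibility in a chain ring\<close>

context chain_ring
begin

lemma multiple_cases:
  assumes "x \<in> carrier R" "y \<in> carrier R"
  obtains r where "r \<in> carrier R" "x = r \<otimes> y" | r where "r \<in> carrier R" "y = r \<otimes> x"
proof -
  from ideals_chain[OF cgenideal_ideal[OF assms(1)] cgenideal_ideal[OF assms(2)]]
  have "x \<in> PIdl y \<or> y \<in> PIdl x"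
    using cgenideal_self assms by blast
  then show ?thesis using that by (auto simp: cgenideal_def)
qed

text \<open>A chain ring is local: one of \<open>s\<close> and \<open>\<one> \<ominus> s\<close> divides the other, so it divides their sum \<open>\<one>\<close>.\<close>

lemma Units_or_one_minus_Units:
  assumes s: "s \<in> carrier R"
  shows "s \<in> Units R \<or> \<one> \<ominus> s \<in> Units R"
proof -
  have c: "\<one> \<ominus> s \<in> carrier R" using s by simp
  from s c show ?thesis
  proof (cases rule: multiple_cases)
    case (1 r)
    have "(r \<oplus> \<one>) \<otimes> (\<one> \<ominus> s) = r \<otimes> (\<one> \<ominus> s) \<oplus> (\<one> \<ominus> s)"
      using s 1(1) by (simp add: l_distr)
    also have "\<dots> = s \<oplus> (\<one> \<ominus> s)" using 1(2) by simp
    also have "\<dots> = \<one>" using s by algebra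
    finally have "(r \<oplus> \<one>) \<otimes> (\<one> \<ominus> s) = \<one>" .
    moreover have "r \<oplus> \<one> \<in> carrier R" using 1(1) by simp
    moreover have "(\<one> \<ominus> s) \<otimes> (r \<oplus> \<one>) = (r \<oplus> \<one>) \<otimes> (\<one> \<ominus> s)"
      using c 1(1) by (intro m_comm) auto
    ultimately show ?thesis using c
      by (auto simp: Units_def simp del: minus_closed intro!: bexI[of _ "r \<oplus> \<one>"])
  next
    case (2 r)
    have "(r \<oplus> \<one>) \<otimes> s = r \<otimes> s \<oplus> s"
      using s 2(1) by (simp add: l_distr)
    also have "\<dots> = (\<one> \<ominus> s) \<oplus> s" using 2(2) by simp
    also have "\<dots> = \<one>" using s by algebra
    finally have "(r \<oplus> \<one>) \<otimes> s = \<one>" .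
    moreover have "r \<oplus> \<one> \<in> carrier R" using 2(1) by simp
    moreover have "s \<otimes> (r \<oplus> \<one>) = (r \<oplus> \<one>) \<otimes> s" using s 2(1) by (simp add: m_comm)
    ultimately show ?thesis using s by (auto simp: Units_def intro!: bexI[of _ "r \<oplus> \<one>"])
  qed
qed

lemma inv_mult_cancel: "\<lbrakk>k \<in> Units R; x \<in> carrier R\<rbrakk> \<Longrightarrow> inv k \<otimes> (k \<otimes> x) = x"
  by (metis Units_closed Units_inv_closed Units_l_inv l_one m_assoc)

text \<open>Comparability of principal ideals, iterated. Inserting \<open>\<zero>\<close> covers \<open>A = {}\<close>, so that the divisor
  still lies in every ideal containing \<open>A\<close>.\<close>

lemma finite_common_divisor:
  assumes "finite A" "A \<subseteq> carrier R"
  shows "\<exists>a\<in>insert \<zero> A. \<forall>x\<in>A. \<exists>r\<in>carrier R. x = r \<otimes> a"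
  using assms
proof (induction A)
  case empty
  then show ?case by simp
next
  case (insert z A)
  from insert.prems have "A \<subseteq> carrier R" by blast
  then obtain a where a: "a \<in> insert \<zero> A" "\<forall>x\<in>A. \<exists>r\<in>carrier R. x = r \<otimes> a"
    using insert.IH by blast
  have c: "z \<in> carrier R" "a \<in> carrier R" using insert.prems a(1) by auto
  then show ?case
  proof (cases rule: multiple_cases)
    case (1 r)
    then have "\<forall>x\<in>insert z A. \<exists>r\<in>carrier R. x = r \<otimes> a" using a(2) by blast
    then show ?thesis using a(1) by blast
  next
    case (2 r)
    have "\<exists>r'\<in>carrier R. x = r' \<otimes> z" if "x \<in> A" for x
    proof -
      from a(2) that obtain t where "t \<in> carrier R" "x = t \<otimes> a" by blast
      then have "x = (t \<otimes> r) \<otimes> z" "t \<otimes> r \<in> carrier R" using 2 c by (auto simp: m_assoc)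
      then show ?thesis by blast
    qed
    moreover have "\<exists>r\<in>carrier R. z = r \<otimes> z" using c by (intro bexI[of _ \<one>]) auto
    ultimately show ?thesis by blast
  qed
qed

text \<open>The generator \<open>b\<close> is a common divisor of the images of the unit vectors, and the quotients of these
  images by \<open>b\<close> are the coefficients of \<open>\<phi>\<close>. The last conclusion allows \<open>b\<close> to be exchanged for any other
  element of \<open>I\<close>, which is how a lift will be produced.\<close>

lemma mod_hom_free_module_principal:
  assumes I: "ideal I R" and h: "h \<in> mod_hom R (free_module R n) (ideal_module R I)"
  obtains b \<phi> where "b \<in> I" "\<phi> \<in> carrier (free_module R n) \<rightarrow> carrier R"
    "\<And>x. x \<in> carrier (free_module R n) \<Longrightarrow> h x = \<phi> x \<otimes> b"
    "\<And>y. y \<in> I \<Longrightarrow> (\<lambda>x. \<phi> x \<otimes> y) \<in> mod_hom R (free_module R n) (ideal_module R I)"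
proof -
  interpret I: ideal I R by (rule I)
  let ?c = "\<lambda>i. h (\<lambda>j\<in>{..<n}. if j = i then \<one> else \<zero>)"
  have c: "?c i \<in> I" for i using mod_homD(1)[OF h, of "\<lambda>j\<in>{..<n}. if j = i then \<one> else \<zero>"] by auto
  then have "?c ` {..<n} \<subseteq> carrier R" using I.Icarr by blast
  then obtain b where b: "b \<in> insert \<zero> (?c ` {..<n})"
    "\<forall>x\<in>?c ` {..<n}. \<exists>r\<in>carrier R. x = r \<otimes> b"
    using finite_common_divisor[of "?c ` {..<n}"] by blast
  then have bI: "b \<in> I" using c by auto
  then have bc: "b \<in> carrier R" by (rule I.Icarr)
  from b(2) have "\<forall>i\<in>{..<n}. \<exists>r. r \<in> carrier R \<and> ?c i = r \<otimes> b" by blast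
  from bchoice[OF this] obtain r where r: "\<And>i. i < n \<Longrightarrow> r i \<in> carrier R \<and> ?c i = r i \<otimes> b"
    by blast
  let ?\<phi> = "\<lambda>x. \<Oplus>i\<in>{..<n}. x i \<otimes> r i"
  show ?thesis
  proof (rule that[of b ?\<phi>])
    show "?\<phi> \<in> carrier (free_module R n) \<rightarrow> carrier R"
      using r by (intro Pi_I finsum_closed) auto
    fix x assume "x \<in> carrier (free_module R n)"
    then have x: "x \<in> {..<n} \<rightarrow>\<^sub>E carrier R" by simp
    have "h x = (\<Oplus>i\<in>{..<n}. x i \<otimes> ?c i)"
      by (rule mod_hom_free_module_expand[OF I h x])
    also have "\<dots> = (\<Oplus>i\<in>{..<n}. (x i \<otimes> r i) \<otimes> b)"
      using x r bc by (intro finsum_cong') (auto simp: m_assoc PiE_iff)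
    also have "\<dots> = ?\<phi> x \<otimes> b"
      using x r bc by (intro finsum_ldistr[symmetric]) auto
    finally show "h x = ?\<phi> x \<otimes> b" .
  next
    fix y assume "y \<in> I"
    then show "(\<lambda>x. ?\<phi> x \<otimes> y) \<in> mod_hom R (free_module R n) (ideal_module R I)"
      using r by (intro linear_form_mod_hom[OF I]) auto
  qed (rule bI)
qed

section \<open>Nilpotent zerodivisors give self-flat ideals\<close>

text \<open>The hypothesis on \<open>e\<close> reproduces itself. Let \<open>p d = u e\<close>. Then \<open>e\<close> and \<open>r \<otimes> w \<otimes> d\<close> differ by some
  \<open>j\<close> in the kernel of \<open>p\<close>. Since \<open>e\<close> lies outside the kernel, \<open>j = s \<otimes> e\<close> with a non-unit \<open>s\<close>, and
  \<open>\<one> \<ominus> s\<close> is a unit, so \<open>e = r \<otimes> w' \<otimes> d\<close>. Applying \<open>p\<close> and \<open>u\<close> to this equation shows \<open>p d \<noteq> 0\<close> and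
  \<open>p d = (r \<otimes> w') \<odot> u d\<close>. Each round gains a factor \<open>r\<close>; the cofactor \<open>w\<close> absorbs the units.\<close>

lemma divisible_by_powers:
  assumes I: "ideal I R" and M': "module R M'"
    and p: "p \<in> mod_epi R (ideal_module R I) M'" and u: "u \<in> mod_hom R (ideal_module R I) M'"
    and r: "r \<in> carrier R" and w: "w \<in> carrier R"
    and e: "e \<in> I" "p e \<noteq> \<zero>\<^bsub>M'\<^esub>" "p e = (r \<otimes> w) \<odot>\<^bsub>M'\<^esub> u e"
  shows "\<exists>t\<in>carrier R. e = r [^] (n::nat) \<otimes> t"
  using w e
proof (induction n arbitrary: e w)
  case 0
  then show ?case using ideal.Icarr[OF I] by (auto intro!: bexI[of _ e])
next
  case (Suc n)
  interpret I: ideal I R by (rule I)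
  interpret M': module R M' by (rule M')
  have ph: "p \<in> mod_hom R (ideal_module R I) M'" using p by (simp add: mod_epi_def)
  note pD = mod_homD[OF ph, simplified] and uD = mod_homD[OF u, simplified]
  note w = Suc.prems(1) and e = Suc.prems(2-4)
  have ec: "e \<in> carrier R" using e(1) by (rule I.Icarr)
  have "u e \<in> p ` I" using p uD(1)[OF e(1)] by (auto simp: mod_epi_def)
  then obtain d where d: "d \<in> I" "p d = u e" by auto
  have dc: "d \<in> carrier R" using d(1) by (rule I.Icarr)
  define j where "j = e \<oplus> \<ominus> (r \<otimes> w \<otimes> d)"
  have rwd: "r \<otimes> w \<otimes> d \<in> I" using r w d(1) by (simp add: I.I_l_closed)
  have jI: "j \<in> I" unfolding j_def using e(1) rwd by simp
  have jc: "j \<in> carrier R" using jI by (rule I.Icarr)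
  have ej: "e = j \<oplus> r \<otimes> w \<otimes> d" unfolding j_def using ec r w dc by algebra
  have "p e = p j \<oplus>\<^bsub>M'\<^esub> p (r \<otimes> w \<otimes> d)" using pD(2)[OF jI rwd] ej by simp
  also have "p (r \<otimes> w \<otimes> d) = p e" using pD(3)[of "r \<otimes> w" d] r w d e by simp
  finally have pj: "p j = \<zero>\<^bsub>M'\<^esub>"
    using pD(1)[OF jI] pD(1)[OF e(1)] by (metis M'.l_zero M'.a_comm M'.add.l_cancel M'.zero_closed)
  have not_multiple: False if "t \<in> carrier R" "e = t \<otimes> j" for t
    using that pD(3)[of t j] jI pj e(2) by simp
  obtain s where s: "s \<in> carrier R" "j = s \<otimes> e"
    using ec jc not_multiple by (cases rule: multiple_cases) auto
  have "s \<notin> Units R"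
  proof
    assume su: "s \<in> Units R"
    have "e = inv s \<otimes> j" using s ec su by (simp add: inv_mult_cancel)
    then show False using not_multiple su by blast
  qed
  then have v: "\<one> \<ominus> s \<in> Units R" using Units_or_one_minus_Units s by blast
  define w' where "w' = w \<otimes> inv (\<one> \<ominus> s)"
  have w': "w' \<in> carrier R" using w v by (simp add: w'_def)
  have "(\<one> \<ominus> s) \<otimes> e = e \<ominus> s \<otimes> e" using s(1) ec by algebra
  also have "\<dots> = (j \<oplus> r \<otimes> w \<otimes> d) \<ominus> j" by (simp only: ej[symmetric] s(2)[symmetric])
  also have "\<dots> = r \<otimes> w \<otimes> d" using jc r w dc by algebra
  finally have "(\<one> \<ominus> s) \<otimes> e = r \<otimes> w \<otimes> d" .
  then have "e = inv (\<one> \<ominus> s) \<otimes> (r \<otimes> w \<otimes> d)" using inv_mult_cancel[OF v ec] by simp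
  also have "\<dots> = r \<otimes> w' \<otimes> d" using Units_inv_closed[OF v] r w dc by (simp add: m_ac w'_def)
  finally have erd: "e = r \<otimes> w' \<otimes> d" .
  have "p e = (r \<otimes> w') \<odot>\<^bsub>M'\<^esub> p d" using pD(3)[of "r \<otimes> w'" d] erd r w' d by simp
  then have pd0: "p d \<noteq> \<zero>\<^bsub>M'\<^esub>" using e(2) r w' by auto
  have "p d = u (r \<otimes> w' \<otimes> d)" using d erd by simp
  also have "\<dots> = (r \<otimes> w') \<odot>\<^bsub>M'\<^esub> u d" using uD(3)[of "r \<otimes> w'" d] r w' d by simp
  finally obtain t where t: "t \<in> carrier R" "d = r [^] n \<otimes> t"
    using Suc.IH[OF w' d(1) pd0] by blast
  have "e = r [^] Suc n \<otimes> (w' \<otimes> t)"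
    unfolding erd t(2) using r w' t by (simp add: m_ac)
  then show ?case using w' t(1) by blast
qed

text \<open>Only a lift \<open>c\<close> of \<open>u b\<close> with \<open>p c \<noteq> 0\<close> and \<open>a \<otimes> c \<noteq> \<zero>\<close> needs an argument. It forces \<open>b = r \<otimes> c\<close>
  with a zerodivisor \<open>r\<close>; then \<open>c\<close> is divisible by all powers of \<open>r\<close>, and one of these is \<open>\<zero>\<close>.\<close>

lemma annihilated_lift:
  assumes ZN: "zerodivisors R \<subseteq> nilradical R" and I: "ideal I R" and M': "module R M'"
    and p: "p \<in> mod_epi R (ideal_module R I) M'" and u: "u \<in> mod_hom R (ideal_module R I) M'"
    and a: "a \<in> carrier R" and b: "b \<in> I" and ab: "a \<otimes> b = \<zero>"
  shows "\<exists>y\<in>I. a \<otimes> y = \<zero> \<and> p y = u b"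
proof -
  interpret I: ideal I R by (rule I)
  interpret M': module R M' by (rule M')
  have ph: "p \<in> mod_hom R (ideal_module R I) M'" using p by (simp add: mod_epi_def)
  note pD = mod_homD[OF ph, simplified] and uD = mod_homD[OF u, simplified]
  have p0: "p \<zero> = \<zero>\<^bsub>M'\<^esub>" using mod_hom_zero[OF module_ideal_module[OF I] M' ph] by simp
  have "u b \<in> p ` I" using p uD(1)[OF b] by (auto simp: mod_epi_def)
  then obtain c where c: "c \<in> I" "p c = u b" by auto
  have cc: "c \<in> carrier R" and bc: "b \<in> carrier R" using c b by auto
  consider "p c = \<zero>\<^bsub>M'\<^esub>" | "a \<otimes> c = \<zero>" | "p c \<noteq> \<zero>\<^bsub>M'\<^esub>" "a \<otimes> c \<noteq> \<zero>" by blast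
  then show ?thesis
  proof cases
    case 1
    then show ?thesis using c p0 a by (intro bexI[of _ \<zero>]) auto
  next
    case 2
    then show ?thesis using c by blast
  next
    case 3
    obtain r where r: "r \<in> carrier R" "b = r \<otimes> c"
      using bc cc
    proof (cases rule: multiple_cases)
      case (2 r)
      then have "a \<otimes> c = r \<otimes> (a \<otimes> b)" using a bc by (simp add: m_ac)
      then show ?thesis using 3 ab 2 by simp
    qed
    have "r \<otimes> (a \<otimes> c) = \<zero>" using ab r a cc by (simp add: m_ac)
    then have "r \<in> zerodivisors R"
      using 3 r a cc by (auto simp: zerodivisors_def)
    then obtain n :: nat where n: "r [^] n = \<zero>" using ZN by (auto simp: nilradical_def)
    have "p c = (r \<otimes> \<one>) \<odot>\<^bsub>M'\<^esub> u c" using c r uD(3)[of r c] by simp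
    then obtain t where "t \<in> carrier R" "c = r [^] n \<otimes> t"
      using divisible_by_powers[OF I M' p u r(1) one_closed c(1) 3(1)] by blast
    then show ?thesis using n 3 p0 by simp
  qed
qed

text \<open>Both \<open>v\<close> and the relations of \<open>G\<close> become principal, which reduces the lifting problem to
  \<open>annihilated_lift\<close>.\<close>

lemma self_flat_ideal:
  assumes ZN: "zerodivisors R \<subseteq> nilradical R" and I: "ideal I R"
  shows "self_flat R (ideal_module R I)"
  unfolding self_flat_def rel_flat_def
proof (intro allI impI, elim conjE)
  fix M' :: "('a, 'a set) module" and p u and G :: "('a, (nat \<Rightarrow> 'a) set) module" and v
  assume M': "module R M'" and p: "p \<in> mod_epi R (ideal_module R I) M'"
    and u: "u \<in> mod_hom R (ideal_module R I) M'"
    and fp: "finitely_presented R G" and v: "v \<in> mod_hom R G (ideal_module R I)"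
  interpret I: ideal I R by (rule I)
  interpret M': module R M' by (rule M')
  have ph: "p \<in> mod_hom R (ideal_module R I) M'" using p by (simp add: mod_epi_def)
  note pD = mod_homD[OF ph, simplified] and uD = mod_homD[OF u, simplified]
  note V = module_ideal_module[OF I]
  from fp obtain n f S where G: "module R G" and f: "f \<in> mod_epi R (free_module R n) G"
    and S: "finite S" "S \<subseteq> carrier (free_module R n)"
      "{x \<in> carrier (free_module R n). f x = \<zero>\<^bsub>G\<^esub>} = (\<lambda>H. submodule H R (free_module R n)) hull S"
    unfolding finitely_presented_def fg_submodule_def by blast
  let ?F = "free_module R n"
  note F = module_free_module[of n]
  have fh: "f \<in> mod_hom R ?F G" and im: "f ` carrier ?F = carrier G"
    using f by (auto simp: mod_epi_def)
  obtain b \<phi> where b: "b \<in> I" and \<phi>: "\<phi> \<in> carrier ?F \<rightarrow> carrier R"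
    and vf: "\<And>x. x \<in> carrier ?F \<Longrightarrow> (v \<circ> f) x = \<phi> x \<otimes> b"
    and lin: "\<And>y. y \<in> I \<Longrightarrow> (\<lambda>x. \<phi> x \<otimes> y) \<in> mod_hom R ?F (ideal_module R I)"
    using mod_hom_free_module_principal[OF I mod_hom_comp[OF fh v]] by blast
  have bc: "b \<in> carrier R" using b by (rule I.Icarr)
  have \<phi>S: "\<phi> ` S \<subseteq> carrier R" using \<phi> S(2) by blast
  then obtain a where a: "a \<in> insert \<zero> (\<phi> ` S)"
    "\<forall>z\<in>\<phi> ` S. \<exists>t\<in>carrier R. z = t \<otimes> a"
    using finite_common_divisor[of "\<phi> ` S"] S(1) by blast
  have ac: "a \<in> carrier R" using a(1) \<phi>S by auto
  \<comment> \<open>\<open>a\<close> is \<open>\<zero>\<close> or a value of \<open>\<phi>\<close> on \<open>ker f\<close>, where \<open>\<phi> x \<otimes> b = v (f x)\<close> vanishes\<close>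
  have "\<phi> x \<otimes> b = \<zero>" if x: "x \<in> S" for x
  proof -
    have "x \<in> {x \<in> carrier ?F. f x = \<zero>\<^bsub>G\<^esub>}" unfolding S(3) using x by (rule hull_inc)
    then show ?thesis using vf[of x] mod_hom_zero[OF G V v] by simp
  qed
  then have ab: "a \<otimes> b = \<zero>" using a(1) bc by auto
  obtain y where y: "y \<in> I" "a \<otimes> y = \<zero>" "p y = u b"
    using annihilated_lift[OF ZN I M' p u ac b ab] by blast
  have yc: "y \<in> carrier R" using y(1) by (rule I.Icarr)
  \<comment> \<open>the kernel of \<open>x \<mapsto> \<phi> x \<otimes> y\<close> is a submodule containing the generators \<open>S\<close> of \<open>ker f\<close>\<close>
  have "\<phi> x \<otimes> y = \<zero>" if x: "x \<in> carrier ?F" "f x = \<zero>\<^bsub>G\<^esub>" for x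
  proof -
    let ?K = "{x \<in> carrier ?F. \<phi> x \<otimes> y = \<zero>}"
    have "S \<subseteq> ?K"
    proof
      fix z assume z: "z \<in> S"
      then obtain t where "t \<in> carrier R" "\<phi> z = t \<otimes> a" using a(2) by auto
      then have "\<phi> z \<otimes> y = \<zero>" using y yc ac by (simp add: m_assoc)
      then show "z \<in> ?K" using z S(2) by blast
    qed
    moreover have "submodule ?K R ?F"
      using submodule_kernel[OF F V lin[OF y(1)]] by simp
    ultimately have "(\<lambda>H. submodule H R ?F) hull S \<subseteq> ?K" by (rule hull_minimal)
    then show ?thesis using x S(3) by blast
  qed
  then obtain q where q: "q \<in> mod_hom R G (ideal_module R I)"
    "\<And>x. x \<in> carrier ?F \<Longrightarrow> q (f x) = \<phi> x \<otimes> y"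
    using mod_epi_factor[OF F G V f lin[OF y(1)]] by auto
  have "p (q g) = u (v g)" if g: "g \<in> carrier G" for g
  proof -
    from g im obtain x where x: "x \<in> carrier ?F" "g = f x" by blast
    have \<phi>x: "\<phi> x \<in> carrier R" using \<phi> x(1) by blast
    have "p (q g) = \<phi> x \<odot>\<^bsub>M'\<^esub> p y" using q(2)[OF x(1)] x(2) pD(3)[OF \<phi>x y(1)] by simp
    also have "\<dots> = u (\<phi> x \<otimes> b)" using y(3) uD(3)[OF \<phi>x b] by simp
    also have "\<dots> = u (v g)" using vf[OF x(1)] x(2) by simp
    finally show ?thesis .
  qed
  with q(1) show "\<exists>q\<in>mod_hom R G (ideal_module R I). \<forall>x\<in>carrier G. p (q x) = u (v x)" by blast
qed

section \<open>A non-nilpotent zerodivisor gives an ideal that is not self-flat\<close>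

lemma nilradical_subset_zerodivisors: "nilradical R \<subseteq> zerodivisors R"
proof
  fix s assume "s \<in> nilradical R"
  then have s: "s \<in> carrier R" and ex: "\<exists>n::nat. s [^] n = \<zero>" by (auto simp: nilradical_def)
  define n where "n = (LEAST n::nat. s [^] n = \<zero>)"
  have n: "s [^] n = \<zero>" unfolding n_def using ex by (rule LeastI_ex)
  show "s \<in> zerodivisors R"
  proof (cases n)
    case 0
    then have "\<one> = \<zero>" using n by simp
    then have "s = \<zero>" using s l_one l_null by metis
    then show ?thesis by (simp add: zerodivisors_def)
  next
    case (Suc m)
    then have "s [^] m \<noteq> \<zero>" unfolding n_def by (metis lessI not_less_Least)
    moreover have "s \<otimes> s [^] m = \<zero>" using n Suc s by (simp add: m_comm)
    ultimately show ?thesis using s by (auto simp: zerodivisors_def)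
  qed
qed

text \<open>If \<open>s \<otimes> t = \<zero>\<close>, then \<open>t\<close> is a multiple of every \<open>s\<^sup>n\<close>, because \<open>s\<^sup>n = r \<otimes> t\<close> would give
  \<open>s\<^sup>n\<^sup>+\<^sup>1 = \<zero>\<close>. For the last claim, any \<open>z\<close> with \<open>x = s \<otimes> z \<noteq> \<zero>\<close> already lies in \<open>I\<close>: otherwise some
  \<open>s\<^sup>n\<close> is a proper multiple of \<open>z\<close>, so \<open>s\<^sup>n\<^sup>+\<^sup>1\<close> is a proper multiple of \<open>x\<close>, while \<open>x\<close> is a multiple of
  \<open>s\<^sup>n\<^sup>+\<^sup>1\<close>; in a local ring this forces \<open>x = \<zero>\<close>.\<close>

lemma Inter_powers:
  fixes s defines "I \<equiv> {x \<in> carrier R. \<forall>n::nat. \<exists>r\<in>carrier R. x = r \<otimes> s [^] n}"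
  assumes s: "s \<in> carrier R" and nonnil: "s \<notin> nilradical R"
  shows "ideal I R"
    and "\<And>t. \<lbrakk>t \<in> carrier R; s \<otimes> t = \<zero>\<rbrakk> \<Longrightarrow> t \<in> I"
    and "\<And>x. x \<in> I \<Longrightarrow> \<exists>z\<in>I. x = s \<otimes> z"
proof -
  have pc: "s [^] n \<in> carrier R" for n :: nat using s by simp
  have pnz: "s [^] n \<noteq> \<zero>" for n :: nat using s nonnil by (auto simp: nilradical_def)
  have "I = (\<Inter>n::nat. PIdl (s [^] n))"
  proof (intro subset_antisym subsetI)
    fix x assume "x \<in> (\<Inter>n::nat. PIdl (s [^] n))"
    then have x: "\<exists>r\<in>carrier R. x = r \<otimes> s [^] n" for n :: nat by (auto simp: cgenideal_def)
    then have "x \<in> carrier R" using x[of 0] by auto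
    then show "x \<in> I" using x by (simp add: I_def)
  qed (auto simp: I_def cgenideal_def)
  then show I: "ideal I R"
    using i_Intersect[of "range (\<lambda>n::nat. PIdl (s [^] n))"] cgenideal_ideal[OF pc] by auto
  show "t \<in> I" if t: "t \<in> carrier R" "s \<otimes> t = \<zero>" for t
    unfolding I_def
  proof (intro CollectI conjI allI)
    fix n :: nat
    show "\<exists>r\<in>carrier R. t = r \<otimes> s [^] n"
      using t(1) pc[of n]
    proof (cases rule: multiple_cases)
      case (2 r)
      have "s [^] Suc n = r \<otimes> (s \<otimes> t)" using 2 s t by (simp add: m_ac)
      then show ?thesis using pnz[of "Suc n"] t 2 by simp
    qed blast
  qed (rule t)
  show "\<exists>z\<in>I. x = s \<otimes> z" if x: "x \<in> I" for x
  proof -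
    have xc: "x \<in> carrier R" using x by (simp add: I_def)
    obtain z where z: "z \<in> carrier R" "x = z \<otimes> s [^] (1::nat)" using x unfolding I_def by blast
    then have xz: "x = s \<otimes> z" using s by (simp add: m_comm)
    show ?thesis
    proof (cases "x = \<zero>")
      case True
      then show ?thesis
        using ideal.axioms(1)[OF I] s additive_subgroup.zero_closed by (intro bexI[of _ \<zero>]) auto
    next
      case False
      have "\<exists>r\<in>carrier R. z = r \<otimes> s [^] n" for n :: nat
        using z(1) pc[of n]
      proof (cases rule: multiple_cases)
        case (2 r)
        obtain y where y: "y \<in> carrier R" "x = y \<otimes> s [^] Suc n" using x unfolding I_def by blast
        have "s [^] Suc n = (r \<otimes> z) \<otimes> s" using 2(2) by simp
        also have "\<dots> = r \<otimes> x" unfolding xz using 2(1) z(1) s by (simp add: m_ac)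
        finally have "y \<otimes> s [^] Suc n = y \<otimes> (r \<otimes> x)" by (rule arg_cong)
        then have yr: "x = (y \<otimes> r) \<otimes> x" using y 2(1) xc by (simp only: m_assoc)
        have yrc: "y \<otimes> r \<in> carrier R" using y 2 by simp
        from Units_or_one_minus_Units[OF yrc] show ?thesis
        proof
          assume "y \<otimes> r \<in> Units R"
          then have r: "r \<in> Units R" using y 2 by (metis unit_factor m_comm)
          then have "z = inv r \<otimes> s [^] n" using 2 z by (simp add: inv_mult_cancel)
          then show ?thesis using r by blast
        next
          assume v: "\<one> \<ominus> y \<otimes> r \<in> Units R"
          have "(\<one> \<ominus> y \<otimes> r) \<otimes> x = x \<ominus> (y \<otimes> r) \<otimes> x" using yrc xc by algebra
          also have "\<dots> = \<zero>" using yr xc by (metis r_neg a_minus_def)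
          finally have "x = inv (\<one> \<ominus> y \<otimes> r) \<otimes> \<zero>" using inv_mult_cancel[OF v xc] by simp
          then have "x = \<zero>" using Units_inv_closed[OF v] by simp
          then show ?thesis using False by simp
        qed
      qed blast
      then show ?thesis using z(1) xz by (auto simp: I_def)
    qed
  qed
qed

text \<open>The test data are \<open>M' = I\<close>, \<open>p\<close> multiplication by \<open>s\<close>, \<open>u\<close> the identity, \<open>G = R/sR\<close> and
  \<open>v\<close> with \<open>v 1 = t\<close>, where \<open>I\<close> is the intersection of the ideals \<open>s\<^sup>nR\<close>.\<close>

lemma ex_not_self_flat_ideal:
  assumes s: "s \<in> zerodivisors R" "s \<notin> nilradical R"
  shows "\<exists>I. ideal I R \<and> \<not> self_flat R (ideal_module R I)"
proof -
  have sc: "s \<in> carrier R" using s(1) by (simp add: zerodivisors_def)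
  have "s [^] (1::nat) \<noteq> \<zero>" using s(2) sc unfolding nilradical_def by blast
  then have "s \<noteq> \<zero>" using sc by simp
  then obtain t where t: "t \<in> carrier R" "t \<noteq> \<zero>" "s \<otimes> t = \<zero>"
    using s(1) by (auto simp: zerodivisors_def)
  define I where "I = {x \<in> carrier R. \<forall>n::nat. \<exists>r\<in>carrier R. x = r \<otimes> s [^] n}"
  note Is = Inter_powers[OF sc s(2), folded I_def]
  interpret I: ideal I R by (rule Is(1))
  have tI: "t \<in> I" by (rule Is(2)[OF t(1,3)])
  let ?V = "ideal_module R I" and ?G = "quotient_module R (PIdl s)"
  note V = module_ideal_module[OF Is(1)]
  note G = module_quotient_module[OF cgenideal_ideal[OF sc]]
  have "\<not> self_flat R ?V"
  proof
    assume flat: "self_flat R ?V"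
    have "(\<otimes>) s ` I = I" using Is(3) I.I_l_closed[OF _ sc] by auto
    then have p: "(\<otimes>) s \<in> mod_epi R ?V ?V"
      using sc by (auto simp: mod_epi_def mod_hom_def r_distr m_lcomm)
    have u: "(\<lambda>x. x) \<in> mod_hom R ?V ?V" by (auto simp: mod_hom_def)
    interpret P: ideal "PIdl s" R by (rule cgenideal_ideal[OF sc])
    let ?f = "\<lambda>x. (PIdl s) +> x (0::nat)"
    note f = quotient_module_presentation[OF sc]
    have x0: "x 0 \<in> carrier R" if "x \<in> carrier (free_module R 1)" for x :: "nat \<Rightarrow> 'a"
      using that by auto
    have "(\<lambda>x. x (0::nat) \<otimes> t) \<in> mod_hom R (free_module R 1) ?V"
      unfolding mod_hom_def
    proof (intro CollectI conjI ballI Pi_I)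
      fix x assume "x \<in> carrier (free_module R 1)"
      then show "x 0 \<otimes> t \<in> carrier ?V" using I.I_l_closed[OF tI x0] by simp
    next
      fix x y assume "x \<in> carrier (free_module R 1)" "y \<in> carrier (free_module R 1)"
      then show "(x \<oplus>\<^bsub>free_module R 1\<^esub> y) 0 \<otimes> t = x 0 \<otimes> t \<oplus>\<^bsub>?V\<^esub> y 0 \<otimes> t"
        using l_distr[OF x0 x0 t(1)] by simp
    next
      fix a x assume "a \<in> carrier R" "x \<in> carrier (free_module R 1)"
      then show "(a \<odot>\<^bsub>free_module R 1\<^esub> x) 0 \<otimes> t = a \<odot>\<^bsub>?V\<^esub> (x 0 \<otimes> t)"
        using m_assoc[OF _ x0 t(1)] by simp
    qed
    moreover have "x 0 \<otimes> t = \<zero>\<^bsub>?V\<^esub>"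
      if "x \<in> carrier (free_module R 1)" "?f x = \<zero>\<^bsub>?G\<^esub>" for x
    proof -
      have xc: "x 0 \<in> carrier R" using that(1) by auto
      then have "x 0 \<in> PIdl s" using that(2) P.rcos_eq_zero_iff[OF xc] by simp
      then obtain a where "a \<in> carrier R" "x 0 = a \<otimes> s" unfolding cgenideal_def by blast
      then show ?thesis using t sc by (simp add: m_assoc)
    qed
    ultimately obtain v where v: "v \<in> mod_hom R ?G ?V"
      "\<And>x. x \<in> carrier (free_module R 1) \<Longrightarrow> v (?f x) = x 0 \<otimes> t"
      using mod_epi_factor[OF module_free_module G V f(1)] by blast
    obtain q where q: "q \<in> mod_hom R ?G ?V" "\<forall>x\<in>carrier ?G. s \<otimes> q x = v x"
      using rel_flatD[OF flat[unfolded self_flat_def] V p u f(2) v(1)] by blast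
    let ?one = "(PIdl s) +> \<one>"
    interpret Q: cring "R Quot PIdl s" by (rule P.quotient_is_cring[OF is_cring])
    interpret h: ring_hom_ring R "R Quot PIdl s" "(+>) (PIdl s)" by (rule P.rcos_ring_hom_ring)
    have one: "?one \<in> carrier ?G" by (simp only: quotient_module_simps h.hom_closed one_closed)
    have "v ?one = t"
      using v(2)[of "\<lambda>i\<in>{..<1}. \<one>"] t(1) by auto
    then have "s \<otimes> q ?one = t" using q(2) one by simp
    moreover have "s \<otimes> q ?one = q (s \<odot>\<^bsub>?G\<^esub> ?one)"
      using mod_homD(3)[OF q(1) sc one] by simp
    moreover have "s \<odot>\<^bsub>?G\<^esub> ?one = (PIdl s) +> s \<otimes> \<one>"
      unfolding quotient_module_simps using h.hom_mult[OF sc one_closed] by (rule sym)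
    then have "s \<odot>\<^bsub>?G\<^esub> ?one = \<zero>\<^bsub>?G\<^esub>"
      using P.rcos_eq_zero_iff[OF sc] cgenideal_self[OF sc] sc by simp
    ultimately show False using t(2) mod_hom_zero[OF G V q(1)] by simp
  qed
  with Is(1) show ?thesis by blast
qed

end

theorem theorem2p11:
  fixes R :: "('a, 'r) ring_scheme" (structure)
  assumes "chain_ring R"
  shows "(\<forall>I. ideal I R \<longrightarrow> self_flat R (ideal_module R I)) \<longleftrightarrow> zerodivisors R = nilradical R"
proof -
  interpret chain_ring R by (rule assms)
  show ?thesis
    using self_flat_ideal ex_not_self_flat_ideal nilradical_subset_zerodivisors by blast
qed

end
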